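(* Let $\mathbb{E}$ be a finite field, let $G$ be a subgroup of $\mathrm{Aut}(\mathbb{E})$, let $\mathbb{F}=\mathbb{E}^G$ be its fixed field, and let $q=|\mathbb{F}|$. Let $d\ge1$ and let $C\colon G\to\mathrm{GL}_d(\mathbb{E})$, $\alpha\mapsto C_\alpha$, be a 1-cocycle, i.e. $C_{\alpha\beta}=C_\alpha\,\alpha(C_\beta)$ for all $\alpha,\beta\in G$. If $X$ is chosen uniformly at random from $\mathbb{E}^{d\times d}$, then the probability that $\Pi_C(X)=\sum_{\alpha\in G}C_\alpha\,\alpha(X)$ is invertible equals $$\frac{|\mathrm{GL}_d(\mathbb{F})|}{|\mathbb{F}^{d\times d}|}=\prod_{i=1}^{d}(1-q^{-i}),$$ and in particular it is at least $\prod_{i=1}^\infty(1-2^{-i})>2/7$.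
   Context: An automorphism $\alpha$ of $\mathbb{E}$ acts on matrices over $\mathbb{E}$ entrywise; automorphisms act on the left and $\alpha\beta=\alpha\circ\beta$. *)

theory Defs
  imports "HOL-Analysis.Analysis" "HOL-Probability.Probability" "HOL-Algebra.Group"
begin

definition field_aut :: "('a::field \<Rightarrow> 'a) set" where
  "field_aut = {\<sigma>. bij \<sigma> \<and> \<sigma> 1 = 1 \<and>
     (\<forall>x y. \<sigma> (x + y) = \<sigma> x + \<sigma> y) \<and> (\<forall>x y. \<sigma> (x * y) = \<sigma> x * \<sigma> y)}"

definition Aut_group :: "('a::field \<Rightarrow> 'a) monoid" where
  "Aut_group = \<lparr>carrier = field_aut, monoid.mult = (\<circ>), one = id\<rparr>"

lemma group_Aut_group: "group (Aut_group :: ('a::field \<Rightarrow> 'a) monoid)"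
proof (rule groupI)
  fix s :: "'a \<Rightarrow> 'a"
  assume "s \<in> carrier Aut_group"
  then have s: "s \<in> field_aut" by (simp add: Aut_group_def)
  then have b: "bij s" by (simp add: field_aut_def)
  have i: "Hilbert_Choice.inv s y = x \<longleftrightarrow> y = s x" for x y
    using b by (metis bij_inv_eq_iff)
  have r: "s (Hilbert_Choice.inv s y) = y" for y
    using b by (simp add: bij_is_surj surj_f_inv_f)
  have "Hilbert_Choice.inv s \<in> field_aut"
    using s b by (auto simp: field_aut_def bij_imp_bij_inv i r)
  moreover have "Hilbert_Choice.inv s \<circ> s = id"
    using b by (simp add: bij_is_inj)
  ultimately show "\<exists>t\<in>carrier Aut_group. t \<otimes>\<^bsub>Aut_group\<^esub> s = \<one>\<^bsub>Aut_group\<^esub>"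
    by (auto simp: Aut_group_def)
qed (auto simp: Aut_group_def field_aut_def bij_comp fun_eq_iff)

definition fixed_field :: "('a::field \<Rightarrow> 'a) set \<Rightarrow> 'a set" where
  "fixed_field G = {x. \<forall>\<alpha>\<in>G. \<alpha> x = x}"

text \<open>In the following, the size \<open>d\<close> of the matrices is \<open>CARD('n)\<close>.\<close>

definition matrices_over :: "'a set \<Rightarrow> ('a^'n^'n) set" where
  "matrices_over F = {A. \<forall>i j. A $ i $ j \<in> F}"

definition GL_over :: "'a::field set \<Rightarrow> ('a^'n^'n) set" where
  "GL_over F = {A \<in> matrices_over F. \<exists>B \<in> matrices_over F. A ** B = mat 1 \<and> B ** A = mat 1}"

text \<open>Only the values of \<open>C\<close> on \<open>G\<close> are relevant.\<close>

definition GL_cocycle :: "('a::field \<Rightarrow> 'a) set \<Rightarrow> (('a \<Rightarrow> 'a) \<Rightarrow> 'a^'n^'n) \<Rightarrow> bool" where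
  "GL_cocycle G C \<longleftrightarrow> (\<forall>\<alpha>\<in>G. C \<alpha> \<in> GL_over UNIV) \<and>
     (\<forall>\<alpha>\<in>G. \<forall>\<beta>\<in>G. C (\<alpha> \<circ> \<beta>) = C \<alpha> ** map_matrix \<alpha> (C \<beta>))"

definition twisted_sum ::
    "('a::field \<Rightarrow> 'a) set \<Rightarrow> (('a \<Rightarrow> 'a) \<Rightarrow> 'a^'n^'n) \<Rightarrow> 'a^'n^'n \<Rightarrow> 'a^'n^'n" where
  "twisted_sum G C X = (\<Sum>\<alpha>\<in>G. C \<alpha> ** map_matrix \<alpha> X)"

text \<open>\<open>prodinf\<close> is only meaningful for convergent products.\<close>

lemma convergent_prod_one_minus_half_powers:
  "convergent_prod (\<lambda>i. 1 - 1 / 2 ^ Suc i :: real)"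
proof -
  have "summable (\<lambda>i. (1/2::real) ^ Suc i)"
    by (subst summable_Suc_iff) (rule summable_geometric, simp)
  then have "abs_convergent_prod (\<lambda>i. 1 - 1 / 2 ^ Suc i :: real)"
    by (intro summable_imp_abs_convergent_prod) (simp add: power_one_over divide_simps)
  then show ?thesis
    by (rule abs_convergent_prod_imp_convergent_prod)
qed

end

theory Submission
  imports Defs
begin

text \<open>
  Dedekind's independence of characters shows that the vectors
  \<open>\<Sum>\<alpha>\<in>G. C \<alpha> *v \<alpha> x\<close> span the whole space (Hilbert's Theorem 90 for \<open>GL\<^sub>d\<close>), so some
  \<open>P = twisted_sum G C X\<close> is invertible. As \<open>C \<alpha> ** \<alpha> P = P\<close>, the twisted sum of \<open>P ** Y\<close> is
  \<open>P\<close> times the entrywise trace of \<open>Y\<close>. The trace is additive and maps onto the fixed field,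
  hence it sends the uniform distribution to the uniform distribution on the matrices over the
  fixed field. The invertible ones among these are counted row by row, since a linear combination
  of independent rational vectors is rational only if its coefficients are.
\<close>

section \<open>Independence of characters\<close>

text \<open>Artin's argument: evaluating the relation at \<open>b * x\<close> and subtracting
  \<open>g b\<close> times the relation at \<open>x\<close> cancels the \<open>g\<close> term,
  leaving a shorter relation with coefficients \<open>k f * (f b - g b)\<close>. Choosing
  \<open>b\<close> with \<open>h b\<close> different from \<open>g b\<close> then forces
  \<open>k h = 0\<close>.\<close>

lemma characters_independent:
  fixes S :: "('b::monoid_mult \<Rightarrow> 'a::idom) set"
  assumes "finite S" and "\<And>f. f \<in> S \<Longrightarrow> f 1 = 1"
    and "\<And>f x y. f \<in> S \<Longrightarrow> f (x * y) = f x * f y"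
    and "\<And>x. (\<Sum>f\<in>S. k f * f x) = 0" and "f \<in> S"
  shows "k f = 0"
  using assms
proof (induction S arbitrary: k f rule: finite_induct)
  case empty
  then show ?case by simp
next
  case (insert g S)
  have k0: "k h = 0" if h: "h \<in> S" for h
  proof -
    have "h \<noteq> g" using h insert.hyps by auto
    then obtain b where b: "h b \<noteq> g b" by auto
    have "(\<Sum>f\<in>S. (k f * (f b - g b)) * f x) = 0" for x
    proof -
      have "(\<Sum>f\<in>insert g S. k f * f (b * x)) - g b * (\<Sum>f\<in>insert g S. k f * f x) = 0"
        by (simp only: insert.prems(3)) simp
      moreover have "(\<Sum>f\<in>S. k f * f (b * x)) = (\<Sum>f\<in>S. k f * f b * f x)"
        using insert.prems(2) by (intro sum.cong) (auto simp: mult.assoc)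
      moreover have "g (b * x) = g b * g x"
        using insert.prems(2) by auto
      ultimately show ?thesis
        using insert.hyps by (simp add: algebra_simps sum_subtractf sum_distrib_left)
    qed
    then have "k h * (h b - g b) = 0"
      using insert.IH[of "\<lambda>f. k f * (f b - g b)" h] insert.prems(1,2) h by auto
    then show ?thesis using b by simp
  qed
  moreover have "k g = 0"
    using insert.prems(3)[of 1] insert.prems(1)[of g] insert.hyps k0 by simp
  ultimately show ?case using insert.prems(4) by auto
qed

section \<open>Fibres of additive maps\<close>

text \<open>Each nonempty fibre is a coset of the kernel, so all have the same size. This is how
  uniformity passes to the image.\<close>

lemma card_vimage_additive:
  fixes h :: "'g::{ab_group_add,finite} \<Rightarrow> 'h::ab_group_add"
  assumes add: "\<And>x y. h (x + y) = h x + h y" and A: "A \<subseteq> range h"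
  shows "card (h -` A) = card (h -` {0}) * card A"
proof -
  have fibre: "card (h -` {a}) = card (h -` {0})" if a: "a \<in> A" for a
  proof -
    obtain x where x: "a = h x" using a A by blast
    have "h -` {a} = (+) x ` (h -` {0})"
    proof (intro Set.set_eqI iffI)
      fix y assume "y \<in> h -` {a}"
      then have "h (y - x) = 0"
        using add[of "y - x" x] x by simp
      then show "y \<in> (+) x ` (h -` {0})"
        by (intro image_eqI[where x = "y - x"]) auto
    qed (auto simp: add x)
    then show ?thesis by (simp add: card_image)
  qed
  have fA: "finite A" using A by (rule finite_subset) simp
  have "card (h -` A) = card (\<Union>a\<in>A. h -` {a})"
    by (intro arg_cong[where f = card]) auto
  also have "\<dots> = (\<Sum>a\<in>A. card (h -` {a}))"
    using fA by (intro card_UN_disjoint) auto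
  also have "\<dots> = card (h -` {0}) * card A"
    by (simp add: fibre)
  finally show ?thesis .
qed

section \<open>Matrices and finite groups of field automorphisms\<close>

text \<open>Stands in for a linear functional vanishing on a proper subspace: \<open>y\<close>
  together with a basis of the span is independent, so a linear map can be prescribed on it
  freely.\<close>

lemma vec_separate_from_span:
  fixes S :: "('a::field^'n) set"
  assumes "y \<notin> vec.span S"
  shows "\<exists>A :: 'a^'n^'n. (\<forall>x\<in>S. A *v x = 0) \<and> A *v y = y"
proof -
  obtain B where B: "B \<subseteq> S" "vec.independent B" "S \<subseteq> vec.span B"
    using vec.maximal_independent_subset by blast
  have y: "y \<notin> vec.span B" using assms vec.span_mono[OF B(1)] by blast
  obtain g where g: "Vector_Spaces.linear (*s) (*s) g"
      "\<forall>x\<in>insert y B. g x = (if x = y then y else 0)"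
    using vec.linear_independent_extend[OF vec.independent_insertI[OF y B(2)],
        of "\<lambda>x. if x = y then y else 0"] by auto
  have "g x = 0" if "x \<in> B" for x
    using g(2) that y vec.span_base by fastforce
  then have "g x = 0" if "x \<in> S" for x
    using vec.linear_eq_0_on_span[OF g(1)] B(3) that by blast
  moreover have "matrix g *v x = g x" for x
    by (rule matrix_works[OF g(1)])
  ultimately show ?thesis using g(2) by (intro exI[of _ "matrix g"]) auto
qed

lemma matrix_mult_sum_right:
  "(A :: 'a::semiring_1^'n^'m) ** (\<Sum>i\<in>I. B i) = (\<Sum>i\<in>I. A ** B i)"
proof (induction I rule: infinite_finite_induct)
  case (insert i I)
  then show ?case by (simp add: matrix_add_ldistrib)
qed (simp_all add: matrix_matrix_mult_def vec_eq_iff)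

lemma matrix_vector_mult_sum_right:
  "(A :: 'a::semiring_1^'n^'m) *v (\<Sum>i\<in>I. x i) = (\<Sum>i\<in>I. A *v x i)"
  by (induction I rule: infinite_finite_induct)
     (simp_all add: matrix_vector_right_distrib)

lemma field_aut_add: "\<alpha> \<in> field_aut \<Longrightarrow> \<alpha> (x + y) = \<alpha> x + \<alpha> y"
  and field_aut_mult: "\<alpha> \<in> field_aut \<Longrightarrow> \<alpha> (x * y) = \<alpha> x * \<alpha> y"
  and field_aut_1: "\<alpha> \<in> field_aut \<Longrightarrow> \<alpha> 1 = 1"
  and field_aut_bij: "\<alpha> \<in> field_aut \<Longrightarrow> bij \<alpha>"
  by (auto simp: field_aut_def)

lemma field_aut_0: "\<alpha> \<in> field_aut \<Longrightarrow> \<alpha> 0 = 0"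
  using field_aut_add[of \<alpha> 0 0] by (metis add.right_neutral add_left_cancel)

lemma field_aut_sum: "\<alpha> \<in> field_aut \<Longrightarrow> \<alpha> (\<Sum>i\<in>I. f i) = (\<Sum>i\<in>I. \<alpha> (f i))"
  by (induction I rule: infinite_finite_induct) (simp_all add: field_aut_0 field_aut_add)

lemma map_matrix_mult:
  "\<alpha> \<in> field_aut \<Longrightarrow> map_matrix \<alpha> (A ** B) = map_matrix \<alpha> A ** map_matrix \<alpha> B"
  by (simp add: vec_eq_iff matrix_matrix_mult_def field_aut_sum field_aut_mult)

lemma map_matrix_mat_1: "\<alpha> \<in> field_aut \<Longrightarrow> map_matrix \<alpha> (mat 1) = mat 1"
  by (simp add: vec_eq_iff mat_def field_aut_0 field_aut_1)

lemma map_matrix_sum: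
  "\<alpha> \<in> field_aut \<Longrightarrow> map_matrix \<alpha> (\<Sum>i\<in>I. A i) = (\<Sum>i\<in>I. map_matrix \<alpha> (A i))"
  by (simp add: vec_eq_iff field_aut_sum)

lemma GL_over_UNIV: "GL_over UNIV = {A. invertible A}"
  by (auto simp: GL_over_def matrices_over_def invertible_def)

locale finite_field_auts =
  fixes G :: "('a::{field,finite} \<Rightarrow> 'a) set"
  assumes subgroup: "subgroup G Aut_group"
begin

abbreviation F :: "'a set" where "F \<equiv> fixed_field G"

lemma aut: "\<alpha> \<in> G \<Longrightarrow> \<alpha> \<in> field_aut"
  using subgroup.subset[OF subgroup] by (auto simp: Aut_group_def)

lemma id_mem: "id \<in> G"
  using subgroup.one_closed[OF subgroup] by (simp add: Aut_group_def)

lemma comp_mem: "\<alpha> \<in> G \<Longrightarrow> \<beta> \<in> G \<Longrightarrow> \<alpha> \<circ> \<beta> \<in> G"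
  using subgroup.m_closed[OF subgroup] by (simp add: Aut_group_def)

text \<open>Left translation by \<open>\<alpha>\<close> is an injective self-map of the finite set
  \<open>G\<close>, hence a permutation.\<close>

lemma sum_comp_left:
  assumes "\<alpha> \<in> G"
  shows "(\<Sum>\<beta>\<in>G. f (\<alpha> \<circ> \<beta>)) = (\<Sum>\<beta>\<in>G. f \<beta>)"
proof -
  have inj: "inj_on ((\<circ>) \<alpha>) G"
    using bij_is_inj[OF field_aut_bij[OF aut[OF assms]]] by (auto simp: inj_on_def fun_eq_iff)
  then have "(\<circ>) \<alpha> ` G = G"
    using comp_mem[OF assms] by (intro endo_inj_surj) auto
  then show ?thesis
    using sum.reindex[OF inj, of f] by simp
qed

text \<open>Automorphisms are characters of the multiplicative monoid of the whole field, zero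
  included.\<close>

lemma auts_independent:
  assumes "\<And>x. (\<Sum>\<alpha>\<in>G. k \<alpha> * \<alpha> x) = 0" and "\<alpha> \<in> G"
  shows "k \<alpha> = 0"
  by (rule characters_independent[of G k]) (use assms aut in \<open>auto simp: field_aut_def\<close>)

lemma fixed_0: "0 \<in> F" and fixed_1: "1 \<in> F"
  and fixed_add: "x \<in> F \<Longrightarrow> y \<in> F \<Longrightarrow> x + y \<in> F"
  and fixed_mult: "x \<in> F \<Longrightarrow> y \<in> F \<Longrightarrow> x * y \<in> F"
  using aut by (auto simp: fixed_field_def field_aut_0 field_aut_1 field_aut_add field_aut_mult)

lemma fixed_sum: "(\<And>i. i \<in> I \<Longrightarrow> f i \<in> F) \<Longrightarrow> (\<Sum>i\<in>I. f i) \<in> F"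
  by (induction I rule: infinite_finite_induct) (auto intro: fixed_0 fixed_add)

lemma card_fixed_ge_2: "card F \<ge> 2"
  using card_mono[of F "{0, 1}"] fixed_0 fixed_1 by auto

section \<open>The trace\<close>

definition field_trace :: "'a \<Rightarrow> 'a" where "field_trace x = (\<Sum>\<alpha>\<in>G. \<alpha> x)"

lemma field_trace_add: "field_trace (x + y) = field_trace x + field_trace y"
  by (simp add: field_trace_def sum.distrib field_aut_add aut)

lemma field_trace_fixed_mult: "c \<in> F \<Longrightarrow> field_trace (c * x) = c * field_trace x"
  unfolding field_trace_def sum_distrib_left
  by (rule sum.cong) (auto simp: field_aut_mult aut fixed_field_def)

text \<open>A vanishing trace would be a relation between automorphisms with all coefficients 1.
  Given one nonzero value, linearity over \<open>F\<close> scales it to any element of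
  \<open>F\<close>. The trace of 1 may itself be 0, so independence supplies the nonzero
  value.\<close>

lemma range_field_trace: "range field_trace = F"
proof (intro Set.set_eqI iffI)
  fix y assume "y \<in> range field_trace"
  then obtain x where y: "y = field_trace x" by auto
  have "\<alpha> (field_trace x) = field_trace x" if "\<alpha> \<in> G" for \<alpha>
    using sum_comp_left[OF that, of "\<lambda>\<beta>. \<beta> x"] by (simp add: field_trace_def field_aut_sum aut that)
  then show "y \<in> F" by (simp add: fixed_field_def y)
next
  fix y assume y: "y \<in> F"
  have "\<exists>x. field_trace x \<noteq> 0"
    using auts_independent[of "\<lambda>_. 1" id] id_mem by (auto simp: field_trace_def)
  then obtain x where x: "field_trace x \<noteq> 0" by auto
  have "field_trace x \<in> F"
    using sum_comp_left[of _ "\<lambda>\<beta>. \<beta> x"] by (simp add: field_trace_def fixed_field_def field_aut_sum aut)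
  then have "inverse (field_trace x) \<in> F"
    using x aut by (auto simp: fixed_field_def)
      (metis field_aut_1 field_aut_mult left_inverse inverse_unique mult.commute)
  then have "field_trace (y * inverse (field_trace x) * x) = y"
    using x y by (simp add: field_trace_fixed_mult fixed_mult)
  then show "y \<in> range field_trace" by (metis rangeI)
qed

lemma range_map_matrix_field_trace:
  "range (map_matrix field_trace :: 'a^'n^'n \<Rightarrow> 'a^'n^'n) = matrices_over F"
proof -
  have "\<exists>X. Y = map_matrix field_trace X" if "Y \<in> matrices_over F" for Y :: "'a^'n^'n"
  proof -
    have "\<forall>i j. \<exists>x. Y $ i $ j = field_trace x"
      using that range_field_trace by (auto simp: matrices_over_def)
    then obtain x where "\<And>i j. Y $ i $ j = field_trace (x i j)" by metis
    then show ?thesis by (intro exI[of _ "\<chi> i j. x i j"]) (simp add: vec_eq_iff)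
  qed
  moreover have "map_matrix field_trace X \<in> matrices_over F" for X :: "'a^'n^'n"
    using range_field_trace by (auto simp: matrices_over_def)
  ultimately show ?thesis by blast
qed

section \<open>Hilbert's Theorem 90\<close>

text \<open>If the span were proper, a matrix \<open>A\<close> would kill it and fix some nonzero
  \<open>y\<close>. Replacing \<open>x\<close> by its multiples turns each coordinate of
  \<open>A *v ?b x = 0\<close> into a relation between automorphisms, whose coefficient at
  \<open>id\<close> gives \<open>A *v (C id *v x) = 0\<close>.\<close>

lemma twisted_vectors_span:
  fixes C :: "('a \<Rightarrow> 'a) \<Rightarrow> 'a^'n^'n"
  assumes "invertible (C id)"
  shows "vec.span (range (\<lambda>x. \<Sum>\<alpha>\<in>G. C \<alpha> *v (\<chi> i. \<alpha> (x $ i)))) = UNIV"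
    (is "vec.span (range ?b) = _")
proof (rule ccontr)
  assume "vec.span (range ?b) \<noteq> UNIV"
  then obtain y where "y \<notin> vec.span (range ?b)" by blast
  then have y: "y \<noteq> 0" using vec.span_zero by blast
  obtain A :: "'a^'n^'n" where A0: "\<forall>x\<in>range ?b. A *v x = 0" and Ay: "A *v y = y"
    using vec_separate_from_span[OF \<open>y \<notin> vec.span (range ?b)\<close>] by blast
  have A: "A *v ?b x = 0" for x
    using A0 by (rule bspec) (rule rangeI)
  have "A *v (C id *v x) = 0" for x
  proof -
    have "(A *v (C id *v x)) $ i = 0" for i
    proof -
      \<comment> \<open>Coordinate \<open>i\<close> for the scaled vector \<open>c *s x\<close>: the
        factors in front of \<open>\<alpha> c\<close> do not depend on \<open>c\<close>.\<close>
      have "(\<Sum>\<alpha>\<in>G. (A *v (C \<alpha> *v (\<chi> j. \<alpha> (x $ j)))) $ i * \<alpha> c) = 0" for c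
      proof -
        have "(\<chi> j. \<alpha> ((c *s x) $ j)) = \<alpha> c *s (\<chi> j. \<alpha> (x $ j))" if "\<alpha> \<in> G" for \<alpha>
          using that by (simp add: vec_eq_iff field_aut_mult aut)
        then have "?b (c *s x) = (\<Sum>\<alpha>\<in>G. \<alpha> c *s (C \<alpha> *v (\<chi> j. \<alpha> (x $ j))))"
          by (intro sum.cong) (auto simp: vec.scale)
        then have "A *v ?b (c *s x) = (\<Sum>\<alpha>\<in>G. \<alpha> c *s (A *v (C \<alpha> *v (\<chi> j. \<alpha> (x $ j)))))"
          by (simp add: matrix_vector_mult_sum_right vec.scale)
        from arg_cong[OF this, of "\<lambda>v. v $ i"] show ?thesis
          unfolding A by (simp add: mult.commute)
      qed
      from auts_independent[OF this id_mem] show ?thesis by simp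
    qed
    then show ?thesis by (simp add: vec_eq_iff)
  qed
  \<comment> \<open>Since \<open>C id\<close> is invertible, \<open>y\<close> has the form
    \<open>C id *v x\<close>.\<close>
  then have "A *v y = 0"
    using assms by (metis invertible_def matrix_vector_mul_assoc matrix_vector_mul_lid)
  then show False using Ay y by simp
qed

lemma cocycle_id:
  fixes C :: "('a \<Rightarrow> 'a) \<Rightarrow> 'a^'n^'n"
  assumes "GL_cocycle G C"
  shows "invertible (C id)"
  using assms id_mem by (auto simp: GL_cocycle_def GL_over_UNIV)

text \<open>Column \<open>j\<close> of the twisted sum depends only on column \<open>j\<close> of
  \<open>X\<close>, and it is the twisted vector of that column. So a basis is picked among the
  twisted vectors, and preimages of its members become the columns of \<open>X\<close>.\<close>

lemma exists_invertible_twisted_sum: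
  fixes C :: "('a \<Rightarrow> 'a) \<Rightarrow> 'a^'n^'n"
  assumes "GL_cocycle G C"
  obtains X where "invertible (twisted_sum G C X)"
proof -
  let ?b = "\<lambda>x::'a^'n. \<Sum>\<alpha>\<in>G. C \<alpha> *v (\<chi> i. \<alpha> (x $ i))"
  obtain B where B: "B \<subseteq> range ?b" "vec.independent B" "range ?b \<subseteq> vec.span B"
    using vec.maximal_independent_subset by blast
  have spB: "vec.span B = UNIV"
    using twisted_vectors_span[of C, OF cocycle_id[OF assms]] vec.span_mono[OF B(3)]
    by (simp add: vec.span_span top_unique)
  have "vec.dim (UNIV :: ('a^'n) set) = card B"
    by (rule vec.dim_eq_card) (simp_all add: spB B(2))
  then have "card B = CARD('n)"
    by (metis vec_dim_card)
  then obtain h where h: "bij_betw h (UNIV :: 'n set) B"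
    by (metis bij_betw_iff_card finite finite_code)
  then have "\<forall>j. \<exists>x. h j = ?b x" using B(1) by (auto simp: bij_betw_def)
  then obtain x where x: "\<And>j. h j = ?b (x j)" by metis
  define X where "X = (\<chi> i j. x j $ i)"
  have "column j (twisted_sum G C X) = h j" for j
    by (simp add: x X_def twisted_sum_def column_def vec_eq_iff matrix_matrix_mult_def
        matrix_vector_mult_def)
  then have "columns (twisted_sum G C X) = B"
    using h by (auto simp: columns_def bij_betw_def)
  then show ?thesis
    using that spB by (metis matrix_right_invertible_span_columns invertible_right_inverse)
qed

text \<open>The cocycle identity sends the term of \<open>\<beta>\<close> to the term of
  \<open>\<alpha> \<circ> \<beta>\<close>, so the sum is only permuted.\<close>

lemma twisted_sum_fixed:
  fixes C :: "('a \<Rightarrow> 'a) \<Rightarrow> 'a^'n^'n"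
  assumes "GL_cocycle G C" and "\<alpha> \<in> G"
  shows "C \<alpha> ** map_matrix \<alpha> (twisted_sum G C X) = twisted_sum G C X"
proof -
  have comp: "map_matrix \<alpha> (map_matrix \<beta> X) = map_matrix (\<alpha> \<circ> \<beta>) X" for \<beta>
    by (simp add: vec_eq_iff)
  have "C \<alpha> ** map_matrix \<alpha> (twisted_sum G C X) =
      (\<Sum>\<beta>\<in>G. (C \<alpha> ** map_matrix \<alpha> (C \<beta>)) ** map_matrix (\<alpha> \<circ> \<beta>) X)"
    by (simp add: twisted_sum_def map_matrix_sum map_matrix_mult aut assms matrix_mult_sum_right
        matrix_mul_assoc flip: comp)
  also have "\<dots> = (\<Sum>\<beta>\<in>G. C (\<alpha> \<circ> \<beta>) ** map_matrix (\<alpha> \<circ> \<beta>) X)"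
    using assms by (intro sum.cong) (auto simp: GL_cocycle_def)
  also have "\<dots> = twisted_sum G C X"
    unfolding twisted_sum_def by (rule sum_comp_left[OF assms(2)])
  finally show ?thesis .
qed

text \<open>An invertible twisted sum \<open>P\<close> exhibits the cocycle as a coboundary:
  \<open>C \<alpha>\<close> is \<open>P\<close> times the inverse of
  \<open>map_matrix \<alpha> P\<close>. Hence \<open>P\<close> factors out of every term.\<close>

lemma twisted_sum_eq_trace:
  fixes C :: "('a \<Rightarrow> 'a) \<Rightarrow> 'a^'n^'n"
  assumes "GL_cocycle G C"
  obtains P :: "'a^'n^'n" where "invertible P" and "\<And>Y. twisted_sum G C (P ** Y) = P ** map_matrix field_trace Y"
proof -
  obtain X where X: "invertible (twisted_sum G C X)"
    using exists_invertible_twisted_sum[OF assms] .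
  define P where "P = twisted_sum G C X"
  have "twisted_sum G C (P ** Y) = P ** map_matrix field_trace Y" for Y
  proof -
    have "twisted_sum G C (P ** Y) = (\<Sum>\<alpha>\<in>G. (C \<alpha> ** map_matrix \<alpha> P) ** map_matrix \<alpha> Y)"
      by (simp add: twisted_sum_def map_matrix_mult aut matrix_mul_assoc)
    also have "\<dots> = P ** (\<Sum>\<alpha>\<in>G. map_matrix \<alpha> Y)"
      using twisted_sum_fixed[OF assms] by (simp add: P_def matrix_mult_sum_right)
    also have "(\<Sum>\<alpha>\<in>G. map_matrix \<alpha> Y) = map_matrix field_trace Y"
      by (simp add: vec_eq_iff field_trace_def)
    finally show ?thesis .
  qed
  from that[OF X[folded P_def] this] show ?thesis .
qed

section \<open>Counting invertible matrices over the fixed field\<close>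

text \<open>Applying \<open>\<alpha>\<close> to the inverse of a matrix over \<open>F\<close> gives
  an inverse of the same matrix; by uniqueness the inverse is fixed.\<close>

lemma GL_over_fixed: "GL_over F = {A \<in> matrices_over F. invertible A}"
proof -
  have "B \<in> matrices_over F"
    if A: "A \<in> matrices_over F" and AB: "A ** B = mat 1" "B ** A = mat 1" for A B :: "'a^'n^'n"
  proof -
    have "map_matrix \<alpha> B = B" if "\<alpha> \<in> G" for \<alpha>
    proof -
      have "map_matrix \<alpha> A = A"
        using A that by (simp add: vec_eq_iff matrices_over_def fixed_field_def)
      then have "map_matrix \<alpha> B ** A = mat 1"
        using map_matrix_mult[OF aut[OF that], of B A] map_matrix_mat_1[OF aut[OF that]] AB
        by metis
      then show ?thesis
        using AB by (metis matrix_mul_assoc matrix_mul_lid matrix_mul_rid)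
    qed
    then show ?thesis
      by (auto simp: matrices_over_def fixed_field_def vec_eq_iff)
  qed
  then show ?thesis
    by (auto simp: GL_over_def invertible_def)
qed

theorem prob_invertible_twisted_sum:
  fixes C :: "('a \<Rightarrow> 'a) \<Rightarrow> 'a^'n^'n"
  assumes "GL_cocycle G C"
  shows "measure_pmf.prob (pmf_of_set UNIV) {X. invertible (twisted_sum G C X)} =
    real (card (GL_over F :: ('a^'n^'n) set)) / real (card (matrices_over F :: ('a^'n^'n) set))"
proof -
  let ?t = "map_matrix field_trace :: 'a^'n^'n \<Rightarrow> 'a^'n^'n"
  define K where "K = card (?t -` {0})"
  obtain P where P: "invertible P" "\<And>Y. twisted_sum G C (P ** Y) = P ** ?t Y"
    using twisted_sum_eq_trace[OF assms] by metis
  obtain Q where Q: "P ** Q = mat 1" "Q ** P = mat 1"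
    using P(1) by (auto simp: invertible_def)
  have inv: "invertible (P ** A) \<longleftrightarrow> invertible A" for A :: "'a^'n^'n"
    using P(1) by (simp add: invertible_det_nz det_mul)
  \<comment> \<open>Substituting \<open>X = P ** Y\<close> turns the event into the preimage of
    \<open>GL_over F\<close> under the entrywise trace.\<close>
  have bij: "bij_betw ((**) P) (?t -` GL_over F) {X. invertible (twisted_sum G C X)}"
  proof (rule bij_betwI[where g = "(**) Q"])
    have t: "?t Y \<in> matrices_over F" for Y
      using range_map_matrix_field_trace by blast
    show "(**) P \<in> ?t -` GL_over F \<rightarrow> {X. invertible (twisted_sum G C X)}"
      by (auto simp: GL_over_fixed P(2) inv)
    show "(**) Q \<in> {X. invertible (twisted_sum G C X)} \<rightarrow> ?t -` GL_over F"
      using t inv P(2) by (auto simp: GL_over_fixed) (metis matrix_mul_assoc matrix_mul_lid Q(1))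
  qed (simp_all add: matrix_mul_assoc Q)
  have add: "?t (X + Y) = ?t X + ?t Y" for X Y
    by (simp add: vec_eq_iff field_trace_add)
  have "card {X. invertible (twisted_sum G C X)} = K * card (GL_over F :: ('a^'n^'n) set)"
    using card_vimage_additive[of ?t "GL_over F", OF add] bij_betw_same_card[OF bij]
      range_map_matrix_field_trace by (auto simp: GL_over_fixed K_def)
  moreover have UNIV_eq: "?t -` range ?t = UNIV" by auto
  moreover have "CARD('a^'n^'n) = K * card (matrices_over F :: ('a^'n^'n) set)"
    using card_vimage_additive[of ?t "range ?t", OF add subset_refl]
    by (simp only: range_map_matrix_field_trace[symmetric] UNIV_eq K_def)
  \<comment> \<open>The kernel size \<open>K\<close> cancels in the quotient; \<open>K = 0\<close>
    would leave no matrices at all.\<close>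
  moreover have "K > 0"
    using calculation(3) by (metis mult_is_0 neq0_conv zero_less_card_finite)
  ultimately show ?thesis
    by (simp add: measure_pmf_of_set)
qed

end

section \<open>Linear independence of indexed families\<close>

definition indep_family :: "'i set \<Rightarrow> ('i \<Rightarrow> 'a::field^'m) \<Rightarrow> bool" where
  "indep_family S f \<longleftrightarrow> (\<forall>c. (\<Sum>i\<in>S. c i *s f i) = 0 \<longrightarrow> (\<forall>i\<in>S. c i = 0))"

text \<open>The span, with coefficients from the whole field and not only from
  \<open>F\<close>.\<close>

definition combinations :: "'i set \<Rightarrow> ('i \<Rightarrow> 'a::field^'m) \<Rightarrow> ('a^'m) set" where
  "combinations S f = range (\<lambda>c. \<Sum>i\<in>S. c i *s f i)"

lemma indep_familyD: "indep_family S f \<Longrightarrow> (\<Sum>i\<in>S. c i *s f i) = 0 \<Longrightarrow> i \<in> S \<Longrightarrow> c i = 0"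
  by (simp add: indep_family_def)

lemma indep_family_cong:
  assumes "\<And>i. i \<in> S \<Longrightarrow> f i = g i"
  shows "indep_family S f \<longleftrightarrow> indep_family S g"
  using assms by (simp add: indep_family_def cong: sum.cong)

lemma combinations_cong:
  assumes "\<And>i. i \<in> S \<Longrightarrow> f i = g i"
  shows "combinations S f = combinations S g"
  using assms by (simp add: combinations_def cong: sum.cong)

text \<open>Allows rows to be chosen one at a time. Indexed families are used instead of sets so
  that a repeated row counts as a dependence.\<close>

lemma indep_family_insert:
  assumes "finite S" "a \<notin> S"
  shows "indep_family (insert a S) f \<longleftrightarrow> indep_family S f \<and> f a \<notin> combinations S f"
proof (intro iffI conjI notI)
  assume ind: "indep_family (insert a S) f"
  show "indep_family S f"
    unfolding indep_family_def
  proof (intro allI impI)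
    fix c assume "(\<Sum>i\<in>S. c i *s f i) = 0"
    moreover have "(\<Sum>i\<in>S. (c(a := 0)) i *s f i) = (\<Sum>i\<in>S. c i *s f i)"
      using assms(2) by (intro sum.cong) auto
    ultimately have "(\<Sum>i\<in>insert a S. (c(a := 0)) i *s f i) = 0"
      using assms by simp
    then have "\<forall>i\<in>insert a S. (c(a := 0)) i = 0"
      using ind unfolding indep_family_def by blast
    then show "\<forall>i\<in>S. c i = 0" using assms(2) by (metis fun_upd_other insertCI)
  qed
  assume "f a \<in> combinations S f"
  then obtain c where c: "f a = (\<Sum>i\<in>S. c i *s f i)" by (auto simp: combinations_def)
  \<comment> \<open>Coefficient -1 at \<open>a\<close> turns the representation of
    \<open>f a\<close> into a nontrivial relation.\<close>
  have "(\<Sum>i\<in>S. (c(a := -1)) i *s f i) = (\<Sum>i\<in>S. c i *s f i)"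
    using assms(2) by (intro sum.cong) auto
  then have "(\<Sum>i\<in>insert a S. (c(a := -1)) i *s f i) = 0"
    using assms c by simp
  then have "(c(a := -1)) a = 0" using ind unfolding indep_family_def by blast
  then show False by simp
next
  assume *: "indep_family S f \<and> f a \<notin> combinations S f"
  show "indep_family (insert a S) f"
    unfolding indep_family_def
  proof (intro allI impI)
    fix c assume "(\<Sum>i\<in>insert a S. c i *s f i) = 0"
    then have eq: "c a *s f a + (\<Sum>i\<in>S. c i *s f i) = 0" using assms by simp
    have "c a = 0"
    proof (rule ccontr)
      assume ca: "c a \<noteq> 0"
      have "f a = inverse (c a) *s (c a *s f a)" using ca by simp
      also have "c a *s f a = - (\<Sum>i\<in>S. c i *s f i)" using eq by (simp add: eq_neg_iff_add_eq_0)
      also have "inverse (c a) *s \<dots> = (\<Sum>i\<in>S. (- inverse (c a) * c i) *s f i)"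
        by (simp add: vec.scale_sum_right sum_negf)
      finally have "f a \<in> combinations S f"
        unfolding combinations_def by (rule range_eqI[where x = "\<lambda>i. - inverse (c a) * c i"])
      then show False using * by simp
    qed
    then show "\<forall>i\<in>insert a S. c i = 0"
      using eq * by (auto simp: indep_family_def)
  qed
qed

section \<open>Counting independent families with entries in the fixed field\<close>

context finite_field_auts
begin

definition fixed_vectors :: "('a^'m) set" where
  "fixed_vectors = {v. \<forall>j. v $ j \<in> F}"

lemma card_fixed_vectors: "card (fixed_vectors :: ('a^'m) set) = card F ^ CARD('m)"
proof -
  have "bij_betw vec_lambda (PiE (UNIV :: 'm set) (\<lambda>_. F)) fixed_vectors"
    by (rule bij_betwI[where g = vec_nth]) (auto simp: fixed_vectors_def)
  then show ?thesis
    using bij_betw_same_card card_PiE[of "UNIV :: 'm set" "\<lambda>_. F"] by fastforce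
qed

lemma card_matrices_over:
  "card (matrices_over F :: ('a^'n^'n) set) = card F ^ (CARD('n) * CARD('n))"
proof -
  have "bij_betw vec_lambda (PiE (UNIV :: 'n set) (\<lambda>_. fixed_vectors))
      (matrices_over F :: ('a^'n^'n) set)"
    by (rule bij_betwI[where g = vec_nth]) (auto simp: fixed_vectors_def matrices_over_def PiE_iff)
  then show ?thesis
    using bij_betw_same_card card_PiE[of "UNIV :: 'n set" "\<lambda>_. fixed_vectors :: ('a^'n) set"]
    by (fastforce simp: card_fixed_vectors power_mult)
qed

text \<open>Applying \<open>\<alpha>\<close> changes neither the vectors \<open>f i\<close> nor
  their combination, so \<open>\<alpha> (c i)\<close> and \<open>c i\<close> are coefficients of the
  same vector and agree by independence.\<close>

lemma fixed_combination:
  fixes f :: "'i \<Rightarrow> 'a^'m"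
  assumes "indep_family S f" and f: "\<And>i. i \<in> S \<Longrightarrow> f i \<in> fixed_vectors"
    and v: "(\<Sum>i\<in>S. c i *s f i) \<in> fixed_vectors" and "i \<in> S"
  shows "c i \<in> F"
proof -
  have "\<alpha> (c i) = c i" if "\<alpha> \<in> G" for \<alpha>
  proof -
    have "(\<Sum>i\<in>S. \<alpha> (c i) * f i $ j) = (\<Sum>i\<in>S. c i * f i $ j)" for j
    proof -
      have "(\<Sum>i\<in>S. \<alpha> (c i) * f i $ j) = \<alpha> ((\<Sum>i\<in>S. c i *s f i) $ j)"
      proof -
        have "\<alpha> (f i $ j) = f i $ j" if "i \<in> S" for i
          using f[OF that] \<open>\<alpha> \<in> G\<close> by (simp add: fixed_vectors_def fixed_field_def)
        then show ?thesis
          using that by (simp add: field_aut_sum field_aut_mult aut)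
      qed
      also have "\<dots> = (\<Sum>i\<in>S. c i * f i $ j)"
        using v that by (simp add: fixed_vectors_def fixed_field_def)
      finally show ?thesis .
    qed
    then have "(\<Sum>i\<in>S. (\<alpha> (c i) - c i) *s f i) = 0"
      by (simp add: vec_eq_iff left_diff_distrib sum_subtractf)
    from indep_familyD[OF assms(1) this \<open>i \<in> S\<close>] have "\<alpha> (c i) - c i = 0" .
    then show ?thesis by simp
  qed
  then show ?thesis by (simp add: fixed_field_def)
qed

text \<open>Coefficient families over \<open>F\<close> correspond bijectively to these vectors:
  independence gives injectivity, \<open>fixed_combination\<close> surjectivity.\<close>

lemma card_fixed_combinations:
  fixes f :: "'i \<Rightarrow> 'a^'m"
  assumes "finite S" and ind: "indep_family S f" and f: "\<And>i. i \<in> S \<Longrightarrow> f i \<in> fixed_vectors"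
  shows "card (fixed_vectors \<inter> combinations S f) = card F ^ card S"
proof -
  let ?L = "\<lambda>c. \<Sum>i\<in>S. c i *s f i"
  have "inj_on ?L (PiE S (\<lambda>_. F))"
  proof (rule inj_onI)
    fix c c' assume c: "c \<in> PiE S (\<lambda>_. F)" "c' \<in> PiE S (\<lambda>_. F)" and "?L c = ?L c'"
    then have "(\<Sum>i\<in>S. (c i - c' i) *s f i) = 0"
      by (simp add: vector_sub_rdistrib vec.scale_left_diff_distrib sum_subtractf)
    from indep_familyD[OF ind this] have "c i = c' i" if "i \<in> S" for i
      using that by simp
    then show "c = c'" by (rule PiE_ext[OF c])
  qed
  moreover have "?L ` PiE S (\<lambda>_. F) = fixed_vectors \<inter> combinations S f"
  proof (intro Set.set_eqI iffI)
    fix v assume "v \<in> ?L ` PiE S (\<lambda>_. F)"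
    then show "v \<in> fixed_vectors \<inter> combinations S f"
      using f by (fastforce simp: fixed_vectors_def combinations_def intro!: fixed_sum fixed_mult)
  next
    fix v assume v: "v \<in> fixed_vectors \<inter> combinations S f"
    then obtain c where c: "v = ?L c" by (auto simp: combinations_def)
    then have "restrict c S \<in> PiE S (\<lambda>_. F)"
      using fixed_combination[OF ind f] v by (intro restrict_PiE_iff[THEN iffD2]) auto
    moreover have "v = ?L (restrict c S)" unfolding c by (intro sum.cong) auto
    ultimately show "v \<in> ?L ` PiE S (\<lambda>_. F)" by blast
  qed
  ultimately show ?thesis
    using card_image[of ?L "PiE S (\<lambda>_. F)"] card_PiE[OF assms(1), of "\<lambda>_. F"] by simp
qed

text \<open>Each new vector must avoid the span of the earlier ones, and the number of excluded
  vectors depends only on how many there are. With more than \<open>CARD('m)\<close> indices, the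
  factor at \<open>i = CARD('m)\<close> makes the product 0.\<close>

lemma card_indep_families:
  assumes "finite (S :: 'i set)"
  shows "card {f \<in> PiE S (\<lambda>_. fixed_vectors :: ('a^'m) set). indep_family S f} =
    (\<Prod>i<card S. card F ^ CARD('m) - card F ^ i)"
  using assms
proof (induction S rule: finite_induct)
  case empty
  show ?case by (simp add: indep_family_def)
next
  case (insert a S)
  let ?V = "fixed_vectors :: ('a^'m) set"
  let ?N = "\<lambda>S::'i set. {f \<in> PiE S (\<lambda>_. ?V). indep_family S f}"
  let ?U = "SIGMA f: ?N S. ?V - combinations S f"
  let ?e = "\<lambda>(f, v). f(a := v)"
  have finN: "finite (?N S)"
    using insert.hyps by (intro finite_subset[OF _ finite_PiE[of S "\<lambda>_. ?V"]]) auto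
  have comb: "combinations S (f(a := v)) = combinations S f"
    and ind: "indep_family S (f(a := v)) = indep_family S f" for f :: "'i \<Rightarrow> 'a^'m" and v
    using insert.hyps by (auto intro!: combinations_cong indep_family_cong)
  have inj: "inj_on ?e ?U"
  proof (rule inj_onI, clarify)
    fix f v f' v'
    assume f: "f \<in> PiE S (\<lambda>_. ?V)" "f' \<in> PiE S (\<lambda>_. ?V)" and eq: "f(a := v) = f'(a := v')"
    have "f i = f' i" if "i \<in> S" for i
      using fun_cong[OF eq, of i] that insert.hyps by (auto split: if_splits)
    then show "f = f' \<and> v = v'"
      using f fun_cong[OF eq, of a] by (auto intro: PiE_ext)
  qed
  have "?e ` ?U = ?N (insert a S)"
  proof (intro Set.set_eqI iffI)
    fix g assume "g \<in> ?e ` ?U"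
    then show "g \<in> ?N (insert a S)"
      using insert.hyps
      by (auto simp: indep_family_insert comb ind dest: PiE_arb split: if_splits)
  next
    fix g assume g: "g \<in> ?N (insert a S)"
    \<comment> \<open>Members of \<open>PiE S\<close> are \<open>undefined\<close> outside
      \<open>S\<close>, so restricting \<open>g\<close> to \<open>S\<close> must reset its value at
      \<open>a\<close>.\<close>
    have "(g(a := undefined), g a) \<in> ?U"
      using g insert.hyps by (auto simp: indep_family_insert comb ind PiE_iff extensional_def)
    then show "g \<in> ?e ` ?U" by (intro image_eqI[of _ _ "(g(a := undefined), g a)"]) auto
  qed
  then have "card (?N (insert a S)) = card ?U"
    using card_image[OF inj] by simp
  also have "\<dots> = (\<Sum>f\<in>?N S. card (?V - combinations S f))"
    using finN by simp
  also have "\<dots> = (\<Sum>f\<in>?N S. card F ^ CARD('m) - card F ^ card S)"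
  proof (rule sum.cong)
    fix f assume f: "f \<in> ?N S"
    have "card (?V - combinations S f) = card ?V - card (?V \<inter> combinations S f)"
      by (simp add: card_Diff_subset_Int)
    also have "card (?V \<inter> combinations S f) = card F ^ card S"
      using f insert.hyps by (intro card_fixed_combinations) auto
    finally show "card (?V - combinations S f) = card F ^ CARD('m) - card F ^ card S"
      by (simp add: card_fixed_vectors)
  qed simp
  finally show ?case
    using insert by simp
qed

text \<open>A matrix is the family of its rows, and it is invertible iff they are
  independent.\<close>

lemma card_GL_over:
  "card (GL_over F :: ('a^'n^'n) set) = (\<Prod>i<CARD('n). card F ^ CARD('n) - card F ^ i)"
proof -
  have inv: "invertible A \<longleftrightarrow> indep_family UNIV (vec_nth A)" for A :: "'a^'n^'n"
    by (simp add: invertible_right_inverse matrix_right_invertible_independent_rows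
        indep_family_def row_def)
  have "bij_betw vec_lambda
      {f \<in> PiE (UNIV :: 'n set) (\<lambda>_. fixed_vectors :: ('a^'n) set). indep_family UNIV f}
      (GL_over F)"
    by (rule bij_betwI[where g = vec_nth])
       (auto simp: GL_over_fixed inv fixed_vectors_def matrices_over_def PiE_iff
          vec_lambda_inverse cong: indep_family_cong)
  then show ?thesis
    using bij_betw_same_card card_indep_families[of "UNIV :: 'n set", where 'm = 'n] by fastforce
qed

lemma GL_over_fraction:
  "real (card (GL_over F :: ('a^'n^'n) set)) / real (card (matrices_over F :: ('a^'n^'n) set)) =
    (\<Prod>i=1..CARD('n). 1 - 1 / real (card F) ^ i)"
proof -
  let ?d = "CARD('n)" and ?q = "real (card F)"
  have q: "?q > 0" using card_fixed_ge_2 by simp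
  have "real (card (GL_over F :: ('a^'n^'n) set)) = (\<Prod>i<?d. ?q ^ ?d - ?q ^ i)"
    \<comment> \<open>No factor is truncated by natural subtraction, because
      \<open>i < CARD('n)\<close>.\<close>
    using card_fixed_ge_2 by (simp add: card_GL_over of_nat_diff power_increasing)
  moreover have "real (card (matrices_over F :: ('a^'n^'n) set)) = (\<Prod>i<?d. ?q ^ ?d)"
    by (simp add: card_matrices_over power_mult)
  ultimately have "real (card (GL_over F :: ('a^'n^'n) set)) /
      real (card (matrices_over F :: ('a^'n^'n) set)) = (\<Prod>i<?d. (?q ^ ?d - ?q ^ i) / ?q ^ ?d)"
    by (simp only: prod_dividef)
  also have "\<dots> = (\<Prod>i<?d. 1 - 1 / ?q ^ (?d - i))"
    using q by (intro prod.cong) (auto simp: diff_divide_distrib power_diff)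
  also have "\<dots> = (\<Prod>i=1..?d. 1 - 1 / ?q ^ i)"
    by (rule prod.reindex_bij_witness[of _ "\<lambda>i. ?d - i" "\<lambda>i. ?d - i"]) auto
  finally show ?thesis .
qed

end

section \<open>Bounds for the product\<close>

text \<open>The factors lie in [0, 1], so partial products decrease to the infinite product;
  moreover each factor grows with \<open>q\<close>.\<close>

lemma prodinf_half_powers_le_prod:
  fixes q :: real
  assumes "q \<ge> 2"
  shows "(\<Prod>i. 1 - 1 / 2 ^ Suc i) \<le> (\<Prod>i=1..d. 1 - 1 / q ^ i)"
proof -
  let ?f = "\<lambda>i. 1 - 1 / 2 ^ Suc i :: real"
  have f: "0 \<le> ?f i" "?f i \<le> 1" for i
    using one_le_power[of "2::real" "Suc i"] by (auto simp: divide_simps)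
  have "prodinf ?f \<le> prod ?f {..<d}"
  proof (rule prodinf_le_const[OF convergent_prod_one_minus_half_powers])
    fix n assume "n \<ge> d"
    then show "prod ?f {..<n} \<le> prod ?f {..<d}"
    proof (induction n rule: dec_induct)
      case (step n)
      have "prod ?f {..<Suc n} \<le> prod ?f {..<n}"
        unfolding prod.lessThan_Suc using f by (intro mult_left_le prod_nonneg) auto
      then show ?case using step.IH by linarith
    qed simp
  qed
  also have "\<dots> \<le> (\<Prod>i<d. 1 - 1 / q ^ Suc i)"
    using f assms by (intro prod_mono) (auto intro!: divide_left_mono power_mono mult_mono)
  also have "\<dots> = (\<Prod>i=1..d. 1 - 1 / q ^ i)"
    by (rule prod.reindex_bij_witness[of _ "\<lambda>i. i - 1" Suc]) auto
  finally show ?thesis .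
qed

text \<open>Here 21/64 is the product of the first three factors. The rest is bounded by one minus
  the sum of the subtracted powers, which is the bracket; at \<open>n = 0\<close> equality
  holds.\<close>

lemma prod_half_powers_lower:
  "(\<Prod>i<n + 3. 1 - 1 / 2 ^ Suc i) \<ge> 21 / 64 * (7 / 8 + 1 / 2 ^ (n + 3) :: real)"
proof (induction n)
  case 0
  show ?case by (simp add: numeral_3_eq_3)
next
  case (Suc n)
  let ?x = "1 / 2 ^ (n + 3) :: real"
  have x: "0 < ?x" "?x \<le> 1 / 8"
    using one_le_power[of "2::real" n] by (auto simp: power_add divide_simps)
  \<comment> \<open>The next factor is \<open>1 - ?x / 2\<close>, and the bound
    \<open>?x \<le> 1 / 8\<close> is exactly what the induction step requires.\<close>
  have "?x * ?x \<le> ?x * (1 / 8)" using x by (intro mult_left_mono) auto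
  then have "7 / 8 + ?x / 2 \<le> (7 / 8 + ?x) * (1 - ?x / 2)"
    by (simp add: algebra_simps)
  then have "21 / 64 * (7 / 8 + ?x / 2) \<le> 21 / 64 * (7 / 8 + ?x) * (1 - ?x / 2)"
    by (simp only: mult.assoc mult_left_mono)
  also have "\<dots> \<le> (\<Prod>i<n + 3. 1 - 1 / 2 ^ Suc i) * (1 - ?x / 2)"
    using Suc.IH x by (intro mult_right_mono) auto
  also have "\<dots> = (\<Prod>i<Suc n + 3. 1 - 1 / 2 ^ Suc i)"
    by (simp only: add_Suc prod.lessThan_Suc) (simp add: power_add)
  finally show ?case by (simp add: power_add)
qed

text \<open>The lower bounds tend to 21/64 * 7/8 = 147/512, which exceeds 2/7 because 147 * 7 = 1029
  > 1024. Splitting off only two factors would give 9/32, which is too small.\<close>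

lemma prodinf_half_powers_gt: "(\<Prod>i. 1 - 1 / 2 ^ Suc i :: real) > 2 / 7"
proof -
  let ?f = "\<lambda>i. 1 - 1 / 2 ^ Suc i :: real"
  have "147 / 512 \<le> prod ?f {..n}" if "n \<ge> 2" for n
  proof -
    \<comment> \<open>The limit theorem uses products up to and including \<open>n\<close>, which
      have \<open>n + 1 = (n - 2) + 3\<close> factors.\<close>
    have "prod ?f {..n} = prod ?f {..<(n - 2) + 3}"
      using that by (simp add: lessThan_Suc_atMost numeral_3_eq_3 flip: Suc_diff_le)
    moreover have "147 / 512 \<le> 21 / 64 * (7 / 8 + 1 / 2 ^ (n - 2 + 3) :: real)"
      by simp
    ultimately show ?thesis using prod_half_powers_lower[of "n - 2"] by linarith
  qed
  then have "147 / 512 \<le> prodinf ?f"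
    by (intro LIMSEQ_le_const[OF convergent_prod_LIMSEQ[OF convergent_prod_one_minus_half_powers]])
      auto
  then show ?thesis by simp
qed

theorem mainTheorem3:
  fixes G :: "('a::{field,finite} \<Rightarrow> 'a) set"
    and C :: "('a \<Rightarrow> 'a) \<Rightarrow> 'a^'n^'n"
    and F :: "'a set" and q d :: nat and p :: real
  assumes "subgroup G Aut_group"
    and "F = fixed_field G"
    and "q = card F"
    and "d = CARD('n)"
    and "GL_cocycle G C"
    and "p = measure_pmf.prob (pmf_of_set (UNIV :: ('a^'n^'n) set)) {X. invertible (twisted_sum G C X)}"
  shows "p = real (card (GL_over F :: ('a^'n^'n) set)) / real (card (matrices_over F :: ('a^'n^'n) set))
    \<and> real (card (GL_over F :: ('a^'n^'n) set)) / real (card (matrices_over F :: ('a^'n^'n) set))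
          = (\<Prod>i=1..d. (1 - 1 / real q ^ i))
    \<and> p \<ge> (\<Prod>i. (1 - 1 / 2 ^ Suc i))
    \<and> (\<Prod>i. (1 - 1 / 2 ^ Suc i :: real)) > 2 / 7"
proof -
  interpret finite_field_auts G by (rule finite_field_auts.intro) (rule assms(1))
  have "real q \<ge> 2" using card_fixed_ge_2 assms(2,3) by simp
  from prodinf_half_powers_le_prod[OF this, of d] show ?thesis
    using prob_invertible_twisted_sum[OF assms(5)] GL_over_fraction[where 'n = 'n]
      prodinf_half_powers_gt assms(2-4,6) by simp
qed

end
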